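(* Let $K$ be a classical knot in $S^3$ with a nontrivial Fox $p$-coloring $\phi:\pi K\rightarrow D_p$, and let $n\in\mathbb{Z}$. Then $\phi$ factors through the quotient map $\pi K\rightarrow \pi(\tau^n K)$ if and only if $n$ is even.
   Context: $\pi K=\pi_1(S^3\setminus K)$ is the knot group. $D_p$ is the dihedral group of order $2p$. A Fox $p$-coloring is a homomorphism $\phi:\pi K\to D_p$ sending meridians to reflections; it is nontrivial if not all meridians have the same image. $\tau^nK$ denotes the $n$-twist spin of $K$ (Zeeman), a 2-knot in $S^4$. Its knot group $\pi(\tau^nK)=\pi_1(S^4\setminus\tau^nK)$ is the quotient of $\pi K$ obtained by making the $n$-th power of a meridian central: if $\langle x_0,\dots,x_m\mid r_1,\dots,r_m\rangle$ is a Wirtinger presentation of $\pi K$ (all generators meridians), then $\pi(\tau^nK)=\langle x_0,\dots,x_m\mid r_1,\dots,r_m,[x_0^n,x_1],\dots,[x_0^n,x_m]\rangle$, and the quotient map $\pi K\to\pi(\tau^nK)$ is the one sending $x_i$ to $x_i$. *)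

theory Defs
  imports "HOL-Analysis.Analysis" "HOL-Algebra.Generated_Groups"
begin

section \<open>The fundamental group\<close>

definition loop_class :: "'a::topological_space set \<Rightarrow> (real \<Rightarrow> 'a) \<Rightarrow> (real \<Rightarrow> 'a) set" where
  "loop_class X p = {q. homotopic_paths X p q}"

definition fundamental_group :: "'a::topological_space set \<Rightarrow> 'a \<Rightarrow> (real \<Rightarrow> 'a) set monoid" where
  "fundamental_group X b =
     \<lparr>carrier = loop_class X ` {p. path p \<and> path_image p \<subseteq> X \<and> pathstart p = b \<and> pathfinish p = b},
      mult = (\<lambda>A B. {r. \<exists>p\<in>A. \<exists>q\<in>B. homotopic_paths X (p +++ q) r}),
      one = loop_class X (\<lambda>_. b)\<rparr>"

lemma group_fundamental_group:
  fixes b :: "'a::real_normed_vector"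
  assumes "b \<in> X"
  shows "group (fundamental_group X b)"
proof -
  let ?L = "{p. path p \<and> path_image p \<subseteq> X \<and> pathstart p = b \<and> pathfinish p = b}"
  let ?m = "\<lambda>A B. {r. \<exists>p\<in>A. \<exists>q\<in>B. homotopic_paths X (p +++ q) r}"
  have triv: "(\<lambda>_. b) = linepath b b"
    by (auto simp: linepath_def algebra_simps)
  have tL: "linepath b b \<in> ?L" using assms by auto
  have eqI: "loop_class X p = loop_class X q" if "homotopic_paths X p q" for p q :: "real \<Rightarrow> 'a"
    using that homotopic_paths_sym homotopic_paths_trans unfolding loop_class_def by blast
  have mul: "?m (loop_class X p) (loop_class X q) = loop_class X (p +++ q)"
    if "p \<in> ?L" "q \<in> ?L" for p q
  proof (intro equalityI subsetI)
    fix r assume "r \<in> ?m (loop_class X p) (loop_class X q)"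
    then obtain p' q' where *: "homotopic_paths X p p'" "homotopic_paths X q q'"
      "homotopic_paths X (p' +++ q') r" unfolding loop_class_def by auto
    have "homotopic_paths X (p +++ q) (p' +++ q')"
      using * that by (intro homotopic_paths_join) auto
    then show "r \<in> loop_class X (p +++ q)"
      using * homotopic_paths_trans unfolding loop_class_def by blast
  next
    fix r assume "r \<in> loop_class X (p +++ q)"
    moreover have "p \<in> loop_class X p" "q \<in> loop_class X q"
      using that unfolding loop_class_def by auto
    ultimately show "r \<in> ?m (loop_class X p) (loop_class X q)"
      unfolding loop_class_def by blast
  qed
  have jL: "p +++ q \<in> ?L" if "p \<in> ?L" "q \<in> ?L" for p q
    using that by (auto simp: path_image_join)
  show ?thesis
  proof (rule groupI, goal_cases)
    case (1 x y)
    then obtain p q where pq: "p \<in> ?L" "q \<in> ?L"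
      and xy: "x = loop_class X p" "y = loop_class X q"
      unfolding fundamental_group_def by auto
    show ?case
      using imageI[OF jL[OF pq], of "loop_class X"] mul[OF pq]
      unfolding fundamental_group_def xy by simp
  next
    case 2
    show ?case using tL unfolding fundamental_group_def triv by auto
  next
    case (3 x y z)
    then obtain p q r where pqr: "p \<in> ?L" "q \<in> ?L" "r \<in> ?L"
      and xyz: "x = loop_class X p" "y = loop_class X q" "z = loop_class X r"
      unfolding fundamental_group_def by auto
    have "homotopic_paths X ((p +++ q) +++ r) (p +++ (q +++ r))"
      using pqr by (intro homotopic_paths_sym[OF homotopic_paths_assoc]) auto
    then have "loop_class X ((p +++ q) +++ r) = loop_class X (p +++ (q +++ r))" by (rule eqI)
    then show ?case
      using mul[OF pqr(1,2)] mul[OF pqr(2,3)] mul[OF jL[OF pqr(1,2)] pqr(3)]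
        mul[OF pqr(1) jL[OF pqr(2,3)]]
      unfolding fundamental_group_def xyz by simp
  next
    case (4 x)
    then obtain p where p: "p \<in> ?L" and x: "x = loop_class X p"
      unfolding fundamental_group_def by auto
    have "homotopic_paths X (linepath b b +++ p) p"
      using homotopic_paths_lid[of p X] p by auto
    then have "loop_class X (linepath b b +++ p) = loop_class X p" by (rule eqI)
    then show ?case using mul[OF tL p] unfolding fundamental_group_def x triv by simp
  next
    case (5 x)
    then obtain p where p: "p \<in> ?L" and x: "x = loop_class X p"
      unfolding fundamental_group_def by auto
    have rL: "reversepath p \<in> ?L" using p by (auto simp: path_image_reversepath)
    have "homotopic_paths X (reversepath p +++ p) (linepath b b)"
      using homotopic_paths_linv[of p X] p by auto
    then have "loop_class X (reversepath p +++ p) = loop_class X (linepath b b)" by (rule eqI)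
    then have "?m (loop_class X (reversepath p)) x = loop_class X (linepath b b)"
      using mul[OF rL p] unfolding x by simp
    then show ?case using imageI[OF rL, of "loop_class X"]
      unfolding fundamental_group_def triv by (intro bexI) simp_all
  qed
qed

section \<open>Knots and meridians\<close>

abbreviation S3 :: "(real^4) set" where
  "S3 \<equiv> sphere 0 1"

text \<open>
  A classical knot is a tame circle in the 3-sphere, that is, the core of an embedded solid torus.
  Such an embedding \<open>h\<close> orients \<open>K\<close> and its meridians.
\<close>

definition tubular_neighborhood :: "(real^4) set \<Rightarrow> (complex \<times> complex \<Rightarrow> real^4) \<Rightarrow> bool" where
  "tubular_neighborhood K h \<longleftrightarrow>
     continuous_on (sphere 0 1 \<times> cball 0 1) h \<and>
     inj_on h (sphere 0 1 \<times> cball 0 1) \<and>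
     h ` (sphere 0 1 \<times> cball 0 1) \<subseteq> S3 \<and>
     h ` (sphere 0 1 \<times> {0}) = K"

abbreviation knot_group :: "(real^4) set \<Rightarrow> real^4 \<Rightarrow> (real \<Rightarrow> real^4) set monoid" where
  "knot_group K b \<equiv> fundamental_group (S3 - K) b"

definition meridian_circle :: "(complex \<times> complex \<Rightarrow> real^4) \<Rightarrow> complex \<Rightarrow> real \<Rightarrow> real^4" where
  "meridian_circle h u = (\<lambda>t. h (u, cis (2 * pi * t)))"

text \<open>
  A meridian runs from the base point to the boundary of a fibre disc, once around the disc, and
  back along the same path. Starting the circle at \<open>h (u, 1)\<close> is no restriction, as the path
  \<open>a\<close> may end with an arc of the circle.
\<close>

definition meridians ::
    "(real^4) set \<Rightarrow> (complex \<times> complex \<Rightarrow> real^4) \<Rightarrow> real^4 \<Rightarrow> (real \<Rightarrow> real^4) set set" where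
  "meridians K h b =
     {loop_class (S3 - K) (a +++ meridian_circle h u +++ reversepath a) | a u.
        u \<in> sphere 0 1 \<and> path a \<and> path_image a \<subseteq> S3 - K \<and>
        pathstart a = b \<and> pathfinish a = h (u, 1)}"

section \<open>Dihedral groups and Fox colorings\<close>

text \<open>
  The pair \<open>(k, f)\<close> stands for \<open>r\<^sup>k s\<^sup>f\<close>, where \<open>r\<close> is the basic rotation of order \<open>p\<close>
  and \<open>s\<close> a reflection, so that \<open>s r s = r\<^sup>-\<^sup>1\<close>.
\<close>

definition dihedral_group :: "nat \<Rightarrow> (int \<times> bool) monoid" where
  "dihedral_group p =
     \<lparr>carrier = {0..<int p} \<times> UNIV,
      mult = (\<lambda>(k, f) (l, g). ((if f then k - l else k + l) mod int p, f \<noteq> g)),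
      one = (0, False)\<rparr>"

definition reflections :: "nat \<Rightarrow> (int \<times> bool) set" where
  "reflections p = {0..<int p} \<times> {True}"

lemma group_dihedral_group:
  assumes "p > 0"
  shows "group (dihedral_group p)"
proof (rule groupI, goal_cases)
  case (1 x y)
  then show ?case using assms by (auto simp: dihedral_group_def)
next
  case 2
  show ?case using assms by (auto simp: dihedral_group_def)
next
  case (3 x y z)
  show ?case
    by (cases x; cases y; cases z)
       (simp add: dihedral_group_def mod_simps diff_diff_eq add.assoc diff_add_eq add_diff_eq diff_diff_eq2)
next
  case (4 x)
  then show ?case by (auto simp: dihedral_group_def)
next
  case (5 x)
  obtain k f where x: "x = (k, f)" by (cases x)
  show ?case
  proof (cases f)
    case True
    then show ?thesis using 5 x by (intro bexI[of _ x]) (auto simp: dihedral_group_def)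
  next
    case False
    then show ?thesis using 5 x assms
      by (intro bexI[of _ "((- k) mod int p, False)"]) (auto simp: dihedral_group_def mod_simps)
  qed
qed

lemma order_dihedral_group: "order (dihedral_group p) = 2 * p"
  by (simp add: order_def dihedral_group_def card_cartesian_product)

definition fox_coloring ::
    "(real^4) set \<Rightarrow> (complex \<times> complex \<Rightarrow> real^4) \<Rightarrow> real^4 \<Rightarrow> nat \<Rightarrow>
     ((real \<Rightarrow> real^4) set \<Rightarrow> int \<times> bool) \<Rightarrow> bool" where
  "fox_coloring K h b p \<phi> \<longleftrightarrow>
     \<phi> \<in> hom (knot_group K b) (dihedral_group p) \<and> \<phi> ` meridians K h b \<subseteq> reflections p"

definition nontrivial_coloring ::
    "(real^4) set \<Rightarrow> (complex \<times> complex \<Rightarrow> real^4) \<Rightarrow> real^4 \<Rightarrow>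
     ((real \<Rightarrow> real^4) set \<Rightarrow> int \<times> bool) \<Rightarrow> bool" where
  "nontrivial_coloring K h b \<phi> \<longleftrightarrow> (\<exists>x\<in>meridians K h b. \<exists>y\<in>meridians K h b. \<phi> x \<noteq> \<phi> y)"

section \<open>The group of a twist spin\<close>

definition normal_closure :: "('a, 'b) monoid_scheme \<Rightarrow> 'a set \<Rightarrow> 'a set" where
  "normal_closure G R = \<Inter> {N. N \<lhd> G \<and> R \<subseteq> N}"

definition commutator :: "('a, 'b) monoid_scheme \<Rightarrow> 'a \<Rightarrow> 'a \<Rightarrow> 'a" where
  "commutator G x y = x \<otimes>\<^bsub>G\<^esub> y \<otimes>\<^bsub>G\<^esub> inv\<^bsub>G\<^esub> x \<otimes>\<^bsub>G\<^esub> inv\<^bsub>G\<^esub> y"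

definition twist_spin_kernel :: "('a, 'b) monoid_scheme \<Rightarrow> 'a \<Rightarrow> int \<Rightarrow> 'a set" where
  "twist_spin_kernel G m n = normal_closure G {commutator G (m [^]\<^bsub>G\<^esub> n) g | g. g \<in> carrier G}"

text \<open>
  For a meridian \<open>m\<close> of \<open>K\<close>, this is the group of the \<open>n\<close>-twist spin of \<open>K\<close>: the knot
  group with \<open>m\<^sup>n\<close> made central.
\<close>

definition twist_spin_group ::
    "(real^4) set \<Rightarrow> real^4 \<Rightarrow> (real \<Rightarrow> real^4) set \<Rightarrow> int \<Rightarrow> (real \<Rightarrow> real^4) set set monoid" where
  "twist_spin_group K b m n = knot_group K b Mod twist_spin_kernel (knot_group K b) m n"

definition twist_spin_quotient_map ::
    "(real^4) set \<Rightarrow> real^4 \<Rightarrow> (real \<Rightarrow> real^4) set \<Rightarrow> int \<Rightarrow>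
     (real \<Rightarrow> real^4) set \<Rightarrow> (real \<Rightarrow> real^4) set set" where
  "twist_spin_quotient_map K b m n g =
     twist_spin_kernel (knot_group K b) m n #>\<^bsub>knot_group K b\<^esub> g"

text \<open>
  Only the commutators with a set of generators are needed. Adding the relators
  \<open>[x\<^sub>0\<^sup>n, x\<^sub>i]\<close> to a Wirtinger presentation therefore gives the same quotient.
\<close>

lemma twist_spin_kernel_generators:
  assumes "group G" "S \<subseteq> carrier G" "generate G S = carrier G" "m \<in> carrier G"
  shows "twist_spin_kernel G m n = normal_closure G {commutator G (m [^]\<^bsub>G\<^esub> n) x | x. x \<in> S}"
proof -
  interpret group G by fact
  let ?a = "m [^]\<^bsub>G\<^esub> n"
  have a: "?a \<in> carrier G" using assms(4) by (rule int_pow_closed)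
  have iff: "{commutator G ?a g | g. g \<in> carrier G} \<subseteq> N \<longleftrightarrow>
        {commutator G ?a x | x. x \<in> S} \<subseteq> N" if "N \<lhd> G" for N
  proof
    show "{commutator G ?a x | x. x \<in> S} \<subseteq> N"
      if "{commutator G ?a g | g. g \<in> carrier G} \<subseteq> N"
      using that assms(2) by blast
  next
    assume S: "{commutator G ?a x | x. x \<in> S} \<subseteq> N"
    interpret N: normal N G by fact
    have conj: "g \<otimes>\<^bsub>G\<^esub> h \<otimes>\<^bsub>G\<^esub> inv\<^bsub>G\<^esub> g \<in> N" if "h \<in> N" "g \<in> carrier G" for g h
      using that N.inv_op_closed2 by blast
    have "commutator G ?a g \<in> N \<and> g \<in> carrier G" if "g \<in> generate G S" for g
      using that
    proof (induction rule: generate.induct)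
      case one
      show ?case using a by (simp add: commutator_def)
    next
      case (incl h)
      then show ?case using S assms(2) by blast
    next
      case (inv h)
      then have h: "h \<in> carrier G" and c: "commutator G ?a h \<in> N" using S assms(2) by blast+
      have "commutator G ?a (inv\<^bsub>G\<^esub> h) =
            inv\<^bsub>G\<^esub> h \<otimes>\<^bsub>G\<^esub> inv\<^bsub>G\<^esub> (commutator G ?a h) \<otimes>\<^bsub>G\<^esub> inv\<^bsub>G\<^esub> (inv\<^bsub>G\<^esub> h)"
        using a h by (simp add: commutator_def inv_mult_group m_assoc inv_solve_left)
      then show ?case using conj[of "inv\<^bsub>G\<^esub> (commutator G ?a h)" "inv\<^bsub>G\<^esub> h"] c h by simp
    next
      case (eng g h)
      have g: "g \<in> carrier G" and h: "h \<in> carrier G" using eng.IH by auto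
      have canc: "inv\<^bsub>G\<^esub> x \<otimes>\<^bsub>G\<^esub> (x \<otimes>\<^bsub>G\<^esub> z) = z" if "x \<in> carrier G" "z \<in> carrier G" for x z
        using that by (simp flip: m_assoc)
      have "commutator G ?a (g \<otimes>\<^bsub>G\<^esub> h) =
            commutator G ?a g \<otimes>\<^bsub>G\<^esub> (g \<otimes>\<^bsub>G\<^esub> commutator G ?a h \<otimes>\<^bsub>G\<^esub> inv\<^bsub>G\<^esub> g)"
        using a g h canc by (simp add: commutator_def inv_mult_group m_assoc)
      then show ?case using conj[of "commutator G ?a h" g] eng.IH g h by simp
    qed
    then show "{commutator G ?a g | g. g \<in> carrier G} \<subseteq> N"
      using assms(3) by blast
  qed
  have "{N. N \<lhd> G \<and> {commutator G ?a g | g. g \<in> carrier G} \<subseteq> N} =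
        {N. N \<lhd> G \<and> {commutator G ?a x | x. x \<in> S} \<subseteq> N}"
    by (rule Collect_cong, rule conj_cong[OF refl], rule iff)
  then show ?thesis
    unfolding twist_spin_kernel_def normal_closure_def by (rule arg_cong)
qed

end

theory Submission
  imports Defs
begin

text \<open>
  A homomorphism \<open>\<phi>\<close> out of a group \<open>G\<close> factors through the quotient making \<open>m\<^sup>n\<close> central
  exactly when \<open>\<phi>(m)\<^sup>n\<close> commutes with the whole image of \<open>\<phi>\<close>
  (\<open>factors_through_twist_spin_iff\<close>). For a coloring, \<open>\<phi>(m)\<close> is a reflection, hence an involution,
  so \<open>\<phi>(m)\<^sup>n\<close> is \<open>1\<close> for even \<open>n\<close> and \<open>\<phi>(m)\<close> for odd \<open>n\<close>. In the even case the condition is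
  vacuous.

  In the odd case it says that \<open>\<phi>(m)\<close> commutes with the image of \<open>\<phi>\<close>. Any two meridians of a knot
  are conjugate (\<open>meridians_conjugate\<close>), so every meridian then has the colour \<open>\<phi>(m)\<close>, and the
  coloring is trivial. Arguing through conjugacy rather than through the center of the dihedral group
  makes the proof uniform in \<open>p\<close>: for even \<open>p\<close> distinct reflections may commute.

  Meridians are conjugate because sliding the fibre disc along the knot sweeps its boundary circle
  over the torus \<open>h (sphere 0 1 \<times> sphere 0 1)\<close>, which is disjoint from the knot. Cutting this sweep
  open gives a map of the plane, in which the homotopy needed is one between two paths with common
  endpoints.
\<close>

section \<open>Homomorphisms out of a quotient by a normal closure\<close>

lemma normal_closure_least: "N \<lhd> G \<Longrightarrow> R \<subseteq> N \<Longrightarrow> normal_closure G R \<subseteq> N"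
  unfolding normal_closure_def by blast

lemma subset_normal_closure: "R \<subseteq> normal_closure G R"
  unfolding normal_closure_def by blast

lemma (in group) normal_normal_closure:
  assumes "R \<subseteq> carrier G"
  shows "normal_closure G R \<lhd> G"
proof -
  have carrier: "carrier G \<lhd> G"
    by (simp add: normal_inv_iff subgroup_self)
  have "subgroup (normal_closure G R) G"
    unfolding normal_closure_def
    using carrier assms by (intro subgroups_Inter) (auto simp: normal_inv_iff)
  then show ?thesis
    unfolding normal_inv_iff by (auto simp: normal_closure_def normal.inv_op_closed2)
qed

lemma (in group_hom) factors_through_normal_closure_iff:
  assumes R: "R \<subseteq> carrier G"
  shows "(\<exists>\<psi>\<in>hom (G Mod normal_closure G R) H.
            \<forall>g\<in>carrier G. h g = \<psi> (normal_closure G R #>\<^bsub>G\<^esub> g))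
         \<longleftrightarrow> (\<forall>r\<in>R. h r = \<one>\<^bsub>H\<^esub>)" (is "?L \<longleftrightarrow> ?R")
proof
  let ?N = "normal_closure G R"
  have N: "?N \<lhd> G" by (rule G.normal_normal_closure[OF R])
  then have sub: "subgroup ?N G" by (rule normal_imp_subgroup)
  show ?R if ?L
  proof
    fix r assume r: "r \<in> R"
    obtain \<psi> where \<psi>: "\<And>g. g \<in> carrier G \<Longrightarrow> h g = \<psi> (?N #>\<^bsub>G\<^esub> g)"
      using \<open>?L\<close> by blast
    have "?N #>\<^bsub>G\<^esub> r = ?N #>\<^bsub>G\<^esub> \<one>\<^bsub>G\<^esub>"
      using subgroup.rcos_const[OF sub G.is_group] subset_normal_closure r
        subgroup.one_closed[OF sub] by (metis subsetD)
    then have "h r = h \<one>\<^bsub>G\<^esub>"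
      using \<psi> R r by (metis G.one_closed subsetD)
    then show "h r = \<one>\<^bsub>H\<^esub>" by simp
  qed
  show ?L if ?R
  proof -
    have "?N \<subseteq> kernel G H h"
      using R \<open>?R\<close> by (intro normal_closure_least normal_kernel) (auto simp: kernel_def)
    from FactGroup_universal_kernel[OF N this] show ?thesis by metis
  qed
qed

lemma (in group) commutator_eq_one_iff:
  assumes "x \<in> carrier G" "y \<in> carrier G"
  shows "commutator G x y = \<one> \<longleftrightarrow> x \<otimes> y = y \<otimes> x"
proof -
  have "commutator G x y = (x \<otimes> y) \<otimes> inv (y \<otimes> x)"
    using assms by (simp add: commutator_def inv_mult_group m_assoc)
  then show ?thesis
    using assms by (metis m_closed inv_closed inv_equality inv_inv r_inv)
qed

lemma (in group_hom) factors_through_twist_spin_iff: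
  assumes m: "m \<in> carrier G"
  shows "(\<exists>\<psi>\<in>hom (G Mod twist_spin_kernel G m n) H.
            \<forall>g\<in>carrier G. h g = \<psi> (twist_spin_kernel G m n #>\<^bsub>G\<^esub> g))
         \<longleftrightarrow> (\<forall>g\<in>carrier G. h m [^]\<^bsub>H\<^esub> n \<otimes>\<^bsub>H\<^esub> h g = h g \<otimes>\<^bsub>H\<^esub> h m [^]\<^bsub>H\<^esub> n)"
proof -
  have a: "m [^]\<^bsub>G\<^esub> n \<in> carrier G"
    using m by (rule G.int_pow_closed)
  have "h (commutator G x y) = commutator H (h x) (h y)"
    if "x \<in> carrier G" "y \<in> carrier G" for x y
    using that by (simp add: commutator_def)
  then have "h (commutator G (m [^]\<^bsub>G\<^esub> n) g) = \<one>\<^bsub>H\<^esub> \<longleftrightarrow>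
      h m [^]\<^bsub>H\<^esub> n \<otimes>\<^bsub>H\<^esub> h g = h g \<otimes>\<^bsub>H\<^esub> h m [^]\<^bsub>H\<^esub> n" if "g \<in> carrier G" for g
    using that a m by (simp add: H.commutator_eq_one_iff hom_int_pow)
  moreover have "{commutator G (m [^]\<^bsub>G\<^esub> n) g | g. g \<in> carrier G} \<subseteq> carrier G"
    using a by (auto simp: commutator_def)
  ultimately show ?thesis
    unfolding twist_spin_kernel_def
    by (subst factors_through_normal_closure_iff) auto
qed

section \<open>Powers of reflections\<close>

lemma reflection_int_pow:
  assumes p: "p > 0" and x: "x \<in> reflections p"
  shows "x [^]\<^bsub>dihedral_group p\<^esub> (n::int) = (if even n then \<one>\<^bsub>dihedral_group p\<^esub> else x)"
proof -
  interpret group "dihedral_group p" by (rule group_dihedral_group[OF p])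
  have xc: "x \<in> carrier (dihedral_group p)"
    and sq: "x \<otimes>\<^bsub>dihedral_group p\<^esub> x = \<one>\<^bsub>dihedral_group p\<^esub>"
    using x by (auto simp: reflections_def dihedral_group_def)
  have even: "x [^]\<^bsub>dihedral_group p\<^esub> (2 * k) = \<one>\<^bsub>dihedral_group p\<^esub>" for k :: int
  proof -
    have "x [^]\<^bsub>dihedral_group p\<^esub> (2::int) = \<one>\<^bsub>dihedral_group p\<^esub>"
      using int_pow_mult[OF xc, of 1 1] sq xc by simp
    then show ?thesis
      using int_pow_pow[OF xc, of 2 k] by simp
  qed
  show ?thesis
  proof (cases "even n")
    case True
    then show ?thesis using even by (auto elim: evenE)
  next
    case False
    then obtain k where "n = 2 * k + 1" by (rule oddE)
    then show ?thesis using int_pow_mult[OF xc, of "2 * k" 1] even xc by simp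
  qed
qed

section \<open>Multiplication of loop classes\<close>

lemma loop_class_eq_iff:
  assumes "path q" "path_image q \<subseteq> X"
  shows "loop_class X p = loop_class X q \<longleftrightarrow> homotopic_paths X p q"
proof
  assume "loop_class X p = loop_class X q"
  moreover have "q \<in> loop_class X q" using assms by (simp add: loop_class_def)
  ultimately show "homotopic_paths X p q" by (simp add: loop_class_def set_eq_iff)
next
  assume "homotopic_paths X p q"
  then show "loop_class X p = loop_class X q"
    unfolding loop_class_def
    using homotopic_paths_sym homotopic_paths_trans by blast
qed

lemma loop_class_in_carrier:
  assumes "path p" "path_image p \<subseteq> X" "pathstart p = b" "pathfinish p = b"
  shows "loop_class X p \<in> carrier (fundamental_group X b)"
  using assms by (auto simp: fundamental_group_def)

lemma mult_loop_class:
  fixes b :: "'a::real_normed_vector"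
  assumes "path p" "path_image p \<subseteq> X" "path q" "path_image q \<subseteq> X" "pathfinish p = pathstart q"
  shows "loop_class X p \<otimes>\<^bsub>fundamental_group X b\<^esub> loop_class X q = loop_class X (p +++ q)"
proof -
  have "homotopic_paths X (p +++ q) r"
    if "homotopic_paths X p p'" "homotopic_paths X q q'" "homotopic_paths X (p' +++ q') r" for p' q' r
    using homotopic_paths_trans[OF homotopic_paths_join[OF that(1,2) assms(5)] that(3)] .
  moreover have "homotopic_paths X p p" "homotopic_paths X q q"
    using assms by simp_all
  ultimately have "(\<exists>p'. homotopic_paths X p p' \<and>
      (\<exists>q'. homotopic_paths X q q' \<and> homotopic_paths X (p' +++ q') r)) \<longleftrightarrow>
      homotopic_paths X (p +++ q) r" for r
    by blast
  then show ?thesis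
    by (simp add: fundamental_group_def loop_class_def)
qed

section \<open>Meridians of a knot are conjugate\<close>

lemma homotopic_paths_cancel_middle:
  fixes x y z :: "real \<Rightarrow> 'a::real_normed_vector"
  assumes "path x" "path_image x \<subseteq> X" "path y" "path_image y \<subseteq> X" "path z" "path_image z \<subseteq> X"
    and "pathfinish x = pathfinish y" "pathfinish y = pathstart z"
  shows "homotopic_paths X ((x +++ reversepath y) +++ (y +++ z)) (x +++ z)"
proof -
  have "homotopic_paths X ((x +++ reversepath y) +++ (y +++ z)) (x +++ (reversepath y +++ (y +++ z)))"
    using assms by (intro homotopic_paths_sym[OF homotopic_paths_assoc]) (auto simp: path_image_join)
  also have "homotopic_paths X \<dots> (x +++ ((reversepath y +++ y) +++ z))"
    using assms by (intro homotopic_paths_join homotopic_paths_assoc) auto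
  also have "homotopic_paths X \<dots> (x +++ (linepath (pathfinish y) (pathfinish y) +++ z))"
    using assms by (intro homotopic_paths_join homotopic_paths_linv) auto
  also have "homotopic_paths X \<dots> (x +++ z)"
    using assms by (intro homotopic_paths_join homotopic_paths_lid') auto
  finally show ?thesis .
qed

text \<open>
  Prefixed with the detour out along \<open>e\<close> and back along \<open>a\<close>, the loop with tail \<open>a\<close> loses its
  outgoing tail, and only \<open>e\<close>, \<open>c\<close> and the way back along \<open>a\<close> remain. The same path arises when the
  detour follows the loop with tail \<open>e\<close>. Stating the conjugacy without inverses means that only
  concatenations have to be compared.
\<close>

lemma change_of_tail_conjugate:
  fixes b :: "'a::real_normed_vector"
  assumes e: "path e" "path_image e \<subseteq> X" "pathstart e = b" "pathfinish e = pathstart c"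
    and a: "path a" "path_image a \<subseteq> X" "pathstart a = b" "pathfinish a = pathstart c"
    and c: "path c" "path_image c \<subseteq> X" "pathfinish c = pathstart c"
  shows "loop_class X (e +++ reversepath a)
           \<otimes>\<^bsub>fundamental_group X b\<^esub> loop_class X (a +++ c +++ reversepath a) =
         loop_class X (e +++ c +++ reversepath e)
           \<otimes>\<^bsub>fundamental_group X b\<^esub> loop_class X (e +++ reversepath a)"
proof -
  note facts = e a c
  have "homotopic_paths X ((e +++ reversepath a) +++ (a +++ (c +++ reversepath a)))
          (e +++ (c +++ reversepath a))"
    using facts by (intro homotopic_paths_cancel_middle) (auto simp: path_image_join)
  also have "homotopic_paths X \<dots> ((e +++ c) +++ reversepath a)"
    using facts by (intro homotopic_paths_assoc) (auto simp: path_image_join)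
  also have "homotopic_paths X \<dots> (((e +++ c) +++ reversepath e) +++ (e +++ reversepath a))"
    using facts by (intro homotopic_paths_sym[OF homotopic_paths_cancel_middle]) (auto simp: path_image_join)
  also have "homotopic_paths X \<dots> ((e +++ (c +++ reversepath e)) +++ (e +++ reversepath a))"
    using facts
    by (intro homotopic_paths_join[OF homotopic_paths_sym[OF homotopic_paths_assoc]]) (auto simp: path_image_join)
  finally have "homotopic_paths X ((e +++ reversepath a) +++ (a +++ (c +++ reversepath a)))
      ((e +++ (c +++ reversepath e)) +++ (e +++ reversepath a))" .
  then show ?thesis
    using facts by (subst (1 2) mult_loop_class) (auto simp: loop_class_eq_iff path_image_join)
qed

lemma homotopic_paths_extend_tail:
  fixes a c c' d :: "real \<Rightarrow> 'a::real_normed_vector"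
  assumes a: "path a" "path_image a \<subseteq> X" "pathfinish a = pathstart d"
    and d: "path d" "path_image d \<subseteq> X" "pathfinish d = pathstart c'"
    and c: "path c" "path_image c \<subseteq> X" "pathstart c = pathstart d" "pathfinish c = pathstart d"
    and c': "path c'" "path_image c' \<subseteq> X" "pathfinish c' = pathstart c'"
    and slide: "homotopic_paths X c (d +++ c' +++ reversepath d)"
  shows "homotopic_paths X (a +++ c +++ reversepath a)
           ((a +++ d) +++ c' +++ reversepath (a +++ d))"
proof -
  note facts = a d c c'
  have "homotopic_paths X (a +++ (c +++ reversepath a))
          (a +++ ((d +++ (c' +++ reversepath d)) +++ reversepath a))"
    using facts by (intro homotopic_paths_join slide) auto
  also have "homotopic_paths X \<dots> (a +++ (d +++ ((c' +++ reversepath d) +++ reversepath a)))"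
    using facts
    by (intro homotopic_paths_join[OF _ homotopic_paths_sym[OF homotopic_paths_assoc]])
      (auto simp: path_image_join)
  also have "homotopic_paths X \<dots> ((a +++ d) +++ ((c' +++ reversepath d) +++ reversepath a))"
    using facts by (intro homotopic_paths_assoc) (auto simp: path_image_join)
  also have "homotopic_paths X \<dots> ((a +++ d) +++ (c' +++ (reversepath d +++ reversepath a)))"
    using facts
    by (intro homotopic_paths_join[OF _ homotopic_paths_sym[OF homotopic_paths_assoc]])
      (auto simp: path_image_join)
  finally show ?thesis
    using a by (simp add: reversepath_joinpaths)
qed

lemma tubular_neighborhood_boundary_torus:
  assumes "tubular_neighborhood K h" "norm u = 1" "norm v = 1"
  shows "h (u, v) \<in> S3 - K"
proof -
  have inj: "inj_on h (sphere 0 1 \<times> cball 0 1)" and K: "h ` (sphere 0 1 \<times> {0}) = K"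
    and S: "h ` (sphere 0 1 \<times> cball 0 1) \<subseteq> S3"
    using assms(1) by (auto simp: tubular_neighborhood_def)
  have "h (u, v) \<noteq> h (w, 0)" if "w \<in> sphere 0 1" for w
    using inj_onD[OF inj, of "(u, v)" "(w, 0)"] that assms(2,3) by auto
  then have "h (u, v) \<notin> K" unfolding K[symmetric] by blast
  moreover have "h (u, v) \<in> S3" using S assms(2,3) by (auto simp: image_subset_iff)
  ultimately show ?thesis by blast
qed

text \<open>
  In the universal cover of the boundary torus, the first meridian circle is one side of a rectangle,
  and the other three sides run along a longitude to the second circle, around it, and back. The two
  longitudinal sides have the same image because they differ by a full turn of the fibre.
\<close>

lemma meridian_circles_homotopic:
  assumes h: "tubular_neighborhood K h" and u: "u \<in> sphere 0 1" and v: "v \<in> sphere 0 1"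
  obtains d where "path d" "path_image d \<subseteq> S3 - K" "pathstart d = h (u, 1)" "pathfinish d = h (v, 1)"
    "homotopic_paths (S3 - K) (meridian_circle h u) (d +++ meridian_circle h v +++ reversepath d)"
proof -
  obtain \<alpha> \<beta> where uv: "u = cis \<alpha>" "v = cis \<beta>"
    using u v by (metis cis_Arg norm_zero mem_sphere_0 rcis_cmod_Arg rcis_def mult_1 of_real_1)
  define T where "T = (\<lambda>(s, t). h (cis s, cis (2 * pi * t)))"
  have T_in: "T z \<in> S3 - K" for z
    using tubular_neighborhood_boundary_torus[OF h] by (simp add: T_def case_prod_unfold)
  have "continuous_on (sphere 0 1 \<times> cball 0 1) h"
    using h by (simp add: tubular_neighborhood_def)
  then have T_cont: "continuous_on UNIV T"
    unfolding T_def case_prod_unfold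
    by (rule continuous_on_compose2) (auto intro!: continuous_intros)
  define d where "d = T \<circ> linepath (\<alpha>, 0) (\<beta>, 0)"
  have path_T: "path (T \<circ> linepath x y)" for x y
    by (intro path_continuous_image continuous_on_subset[OF T_cont]) auto
  have circle: "meridian_circle h (cis s) = T \<circ> linepath (s, 0) (s, 1)" for s
    by (simp add: fun_eq_iff meridian_circle_def T_def linepath_def algebra_simps)
  have rev: "reversepath d = T \<circ> linepath (\<beta>, 1) (\<alpha>, 1)"
    by (simp add: d_def fun_eq_iff reversepath_def T_def linepath_def flip: path_compose_reversepath)
      (simp add: algebra_simps)
  have "homotopic_paths UNIV (linepath (\<alpha>, 0) (\<alpha>, 1::real))
          (linepath (\<alpha>, 0) (\<beta>, 0) +++ linepath (\<beta>, 0) (\<beta>, 1) +++ linepath (\<beta>, 1) (\<alpha>, 1))"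
    by (intro homotopic_paths_linear) auto
  then have "homotopic_paths (S3 - K) (T \<circ> linepath (\<alpha>, 0) (\<alpha>, 1))
      (T \<circ> (linepath (\<alpha>, 0) (\<beta>, 0) +++ linepath (\<beta>, 0) (\<beta>, 1) +++ linepath (\<beta>, 1) (\<alpha>, 1)))"
    using T_in by (intro homotopic_paths_continuous_image[OF _ T_cont]) auto
  then have "homotopic_paths (S3 - K) (meridian_circle h u)
      (d +++ meridian_circle h v +++ reversepath d)"
    unfolding uv circle rev unfolding d_def path_compose_join .
  moreover have "path d" "path_image d \<subseteq> S3 - K"
    using path_T T_in by (simp_all add: d_def path_image_def image_subset_iff del: Diff_iff)
  moreover have "pathstart d = h (u, 1)" "pathfinish d = h (v, 1)"
    by (simp_all add: d_def uv T_def pathstart_def pathfinish_def linepath_def)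
  ultimately show ?thesis using that by blast
qed

lemma meridian_circle_is_loop:
  assumes h: "tubular_neighborhood K h" and u: "u \<in> sphere 0 1"
  shows "path (meridian_circle h u)" "path_image (meridian_circle h u) \<subseteq> S3 - K"
    "pathstart (meridian_circle h u) = h (u, 1)" "pathfinish (meridian_circle h u) = h (u, 1)"
proof -
  obtain d where "homotopic_paths (S3 - K) (meridian_circle h u)
      (d +++ meridian_circle h u +++ reversepath d)"
    using meridian_circles_homotopic[OF h u u] by metis
  then show "path (meridian_circle h u)" "path_image (meridian_circle h u) \<subseteq> S3 - K"
    by (auto dest: homotopic_paths_imp_path homotopic_paths_imp_subset)
qed (simp_all add: meridian_circle_def pathstart_def pathfinish_def)

lemma meridians_subset_carrier:
  assumes "tubular_neighborhood K h"
  shows "meridians K h b \<subseteq> carrier (knot_group K b)"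
proof
  fix x assume "x \<in> meridians K h b"
  then obtain a u where u: "u \<in> sphere 0 1" and a: "path a" "path_image a \<subseteq> S3 - K"
      "pathstart a = b" "pathfinish a = h (u, 1)"
    and x: "x = loop_class (S3 - K) (a +++ meridian_circle h u +++ reversepath a)"
    unfolding meridians_def by blast
  show "x \<in> carrier (knot_group K b)"
    unfolding x using a meridian_circle_is_loop[OF assms u]
    by (intro loop_class_in_carrier) (simp_all add: path_image_join)
qed

text \<open>
  Sliding the circle of the first meridian along the boundary torus onto that of the second
  extends the tail of the first by a longitudinal arc; the meridians then differ only in their
  tails.
\<close>

lemma meridians_conjugate:
  assumes h: "tubular_neighborhood K h"
    and x: "x \<in> meridians K h b" and y: "y \<in> meridians K h b"
  obtains g where "g \<in> carrier (knot_group K b)"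
    "g \<otimes>\<^bsub>knot_group K b\<^esub> y = x \<otimes>\<^bsub>knot_group K b\<^esub> g"
proof -
  let ?X = "S3 - K"
  obtain a u where u: "u \<in> sphere 0 1" and a: "path a" "path_image a \<subseteq> ?X" "pathstart a = b"
      "pathfinish a = h (u, 1)"
    and x_eq: "x = loop_class ?X (a +++ meridian_circle h u +++ reversepath a)"
    using x unfolding meridians_def by blast
  obtain a' v where v: "v \<in> sphere 0 1" and a': "path a'" "path_image a' \<subseteq> ?X" "pathstart a' = b"
      "pathfinish a' = h (v, 1)"
    and y_eq: "y = loop_class ?X (a' +++ meridian_circle h v +++ reversepath a')"
    using y unfolding meridians_def by blast
  obtain d where d: "path d" "path_image d \<subseteq> ?X" "pathstart d = h (u, 1)" "pathfinish d = h (v, 1)"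
    and slide: "homotopic_paths ?X (meridian_circle h u)
      (d +++ meridian_circle h v +++ reversepath d)"
    using meridian_circles_homotopic[OF h u v] .
  let ?c = "meridian_circle h v"
  note c = meridian_circle_is_loop[OF h v]
  note c' = meridian_circle_is_loop[OF h u]
  define e where "e = a +++ d"
  have e: "path e" "path_image e \<subseteq> ?X" "pathstart e = b" "pathfinish e = h (v, 1)"
    using a d by (simp_all add: e_def path_image_join)
  have "homotopic_paths ?X (a +++ meridian_circle h u +++ reversepath a) (e +++ ?c +++ reversepath e)"
    unfolding e_def using slide by (rule homotopic_paths_extend_tail[rotated -1]) (simp_all add: a c c' d)
  then have "x = loop_class ?X (e +++ ?c +++ reversepath e)"
    unfolding x_eq using e c by (subst loop_class_eq_iff) (simp_all add: path_image_join)
  then have "loop_class ?X (e +++ reversepath a') \<otimes>\<^bsub>knot_group K b\<^esub> y =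
      x \<otimes>\<^bsub>knot_group K b\<^esub> loop_class ?X (e +++ reversepath a')"
    unfolding y_eq using e a' c by (simp add: change_of_tail_conjugate)
  moreover have "loop_class ?X (e +++ reversepath a') \<in> carrier (knot_group K b)"
    using e a' by (intro loop_class_in_carrier) (simp_all add: path_image_join)
  ultimately show ?thesis using that by blast
qed

section \<open>Colorings that factor through the group of a twist spin\<close>

theorem proposition5p11:
  fixes K :: "(real^4) set"
    and h :: "complex \<times> complex \<Rightarrow> real^4"
    and b :: "real^4"
    and m :: "(real \<Rightarrow> real^4) set"
    and p :: nat and n :: int
    and \<phi> :: "(real \<Rightarrow> real^4) set \<Rightarrow> int \<times> bool"
  assumes "tubular_neighborhood K h"
    and "b \<in> S3 - K"
    and "m \<in> meridians K h b"
    and "p > 0"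
    and "fox_coloring K h b p \<phi>"
    and "nontrivial_coloring K h b \<phi>"
  shows "(\<exists>\<psi> \<in> hom (twist_spin_group K b m n) (dihedral_group p).
            \<forall>g \<in> carrier (knot_group K b). \<phi> g = \<psi> (twist_spin_quotient_map K b m n g))
         \<longleftrightarrow> even n"
proof -
  let ?G = "knot_group K b" and ?D = "dihedral_group p"
  have "group ?G" by (rule group_fundamental_group[OF assms(2)])
  moreover have "group ?D" by (rule group_dihedral_group[OF assms(4)])
  moreover have hom: "\<phi> \<in> hom ?G ?D" and col: "\<phi> ` meridians K h b \<subseteq> reflections p"
    using assms(5) by (auto simp: fox_coloring_def)
  ultimately interpret group_hom ?G ?D \<phi>
    by (simp add: group_hom_def group_hom_axioms_def)
  note carrier = subsetD[OF meridians_subset_carrier[OF assms(1)]]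
  have pow: "\<phi> m [^]\<^bsub>?D\<^esub> n = (if even n then \<one>\<^bsub>?D\<^esub> else \<phi> m)"
    using col assms(3,4) by (intro reflection_int_pow) auto
  have not_central: False if comm: "\<forall>g\<in>carrier ?G. \<phi> m \<otimes>\<^bsub>?D\<^esub> \<phi> g = \<phi> g \<otimes>\<^bsub>?D\<^esub> \<phi> m"
  proof -
    have "\<phi> y = \<phi> m" if y: "y \<in> meridians K h b" for y
    proof -
      obtain g where g: "g \<in> carrier ?G" "g \<otimes>\<^bsub>?G\<^esub> y = m \<otimes>\<^bsub>?G\<^esub> g"
        using meridians_conjugate[OF assms(1,3) y] .
      then have "\<phi> g \<otimes>\<^bsub>?D\<^esub> \<phi> y = \<phi> m \<otimes>\<^bsub>?D\<^esub> \<phi> g"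
        using carrier y assms(3) by (metis hom_mult)
      also have "\<dots> = \<phi> g \<otimes>\<^bsub>?D\<^esub> \<phi> m" using comm g(1) by blast
      finally show ?thesis using carrier y assms(3) g(1) by simp
    qed
    then show False using assms(6) unfolding nontrivial_coloring_def by metis
  qed
  have "(\<exists>\<psi>\<in>hom (twist_spin_group K b m n) ?D.
            \<forall>g\<in>carrier ?G. \<phi> g = \<psi> (twist_spin_quotient_map K b m n g)) \<longleftrightarrow>
        (\<forall>g\<in>carrier ?G. \<phi> m [^]\<^bsub>?D\<^esub> n \<otimes>\<^bsub>?D\<^esub> \<phi> g = \<phi> g \<otimes>\<^bsub>?D\<^esub> \<phi> m [^]\<^bsub>?D\<^esub> n)"
    unfolding twist_spin_group_def twist_spin_quotient_map_def
    using carrier[OF assms(3)] by (rule factors_through_twist_spin_iff)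
  also have "\<dots> \<longleftrightarrow> even n"
    using not_central by (auto simp: pow)
  finally show ?thesis .
qed

end
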